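(* Let $\mathfrak g$ with ideal $\mathfrak p$ be one of the following: (a) for $\ell\in\frac12\mathbb N$, the conformal Galilei algebra $\mathfrak g^{(\ell)}$ with basis $\{e,h,f,p_k: k=0,1,\dots,2\ell\}$ and nonzero brackets $[h,e]=2e$, $[h,f]=-2f$, $[e,f]=h$, $[h,p_k]=2(\ell-k)p_k$, $[e,p_k]=kp_{k-1}$, $[f,p_k]=(2\ell-k)p_{k+1}$, with $\mathfrak p=\mathrm{Span}\{p_k: 0\le k\le 2\ell\}$; or (b) for $n\in\mathbb N$, the $n$-th Schrödinger algebra $\mathfrak{sch}_n$ with basis $\{h,e,f,x_i,y_i,z: 1\le i\le n\}$ and brackets $[h,e]=2e$, $[h,f]=-2f$, $[e,f]=h$, $[h,x_i]=x_i$, $[e,x_i]=0$, $[f,x_i]=y_i$, $[h,y_i]=-y_i$, $[e,y_i]=x_i$, $[f,y_i]=0$, $[x_i,x_j]=[y_i,y_j]=0$, $[x_i,y_j]=\delta_{ij}z$, $z$ central, with $\mathfrak p=\mathrm{Span}\{x_i,y_i,z:1\le i\le n\}$. Let $\phi:\mathfrak p\to\mathbb C$ be a nonzero Lie algebra homomorphism. Then every irreducible quasi-Whittaker $\mathfrak g$-module of type $\phi$ is bland, i.e., is isomorphic to either $W(\phi)$ or $V(\phi')$ for some Lie algebra homomorphism $\phi':\mathfrak g^\phi\to\mathbb C$ extending $\phi$.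
   Context: A Lie algebra homomorphism to $\mathbb C$ is a linear map vanishing on the derived subalgebra. For a $\mathfrak g$-module $V$, $V_\phi=\{v: pv=\phi(p)v\ \forall p\in\mathfrak p\}$; $V$ is a quasi-Whittaker module of type $\phi$ if it is generated by an element of $V_\phi$; an irreducible such $V$ is bland if $\dim V_\phi=1$. $W(\phi)=\mathcal U(\mathfrak g)\otimes_{\mathcal U(\mathfrak p)}\mathbb C w_\phi$ where $pw_\phi=\phi(p)w_\phi$. $\mathfrak g^{\phi}=\{g\in\mathfrak g:\phi([g,p])=0\ \forall p\in\mathfrak p\}$. For an extension $\phi'$ of $\phi$ to $\mathfrak g^\phi$, $V(\phi')=\mathcal U(\mathfrak g)\otimes_{\mathcal U(\mathfrak g^\phi)}\mathbb C v_{\phi'}$ where $yv_{\phi'}=\phi'(y)v_{\phi'}$. *)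

theory Defs
  imports "HOL-Analysis.Analysis"
begin

text \<open>
A finite-dimensional complex Lie algebra is given by a finite basis \<open>B\<close> (a set of
labels in a type \<open>'b\<close>) and structure constants \<open>br a b c\<close> = coefficient of basis
vector \<open>c\<close> in the bracket \<open>[a,b]\<close>.  A module is a complex vector space, i.e. a type
\<open>'v\<close> with scalar multiplication \<open>sm\<close> satisfying the vector space axioms, together with
linear operators \<open>\<rho> b\<close> for the basis elements satisfying the bracket relations
(this is equivalent to a Lie algebra homomorphism \<open>\<frak>g \<rightarrow> \<frak>gl(V)\<close>).
\<close>

definition is_rep ::
  "(complex \<Rightarrow> 'v::ab_group_add \<Rightarrow> 'v) \<Rightarrow> 'b set \<Rightarrow> ('b \<Rightarrow> 'b \<Rightarrow> 'b \<Rightarrow> complex)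
     \<Rightarrow> ('b \<Rightarrow> 'v \<Rightarrow> 'v) \<Rightarrow> bool" where
  "is_rep sm B br \<rho> \<longleftrightarrow>
     vector_space sm \<and>
     (\<forall>b\<in>B. Vector_Spaces.linear sm sm (\<rho> b)) \<and>
     (\<forall>a\<in>B. \<forall>b\<in>B. \<forall>v. \<rho> a (\<rho> b v) - \<rho> b (\<rho> a v) = (\<Sum>c\<in>B. sm (br a b c) (\<rho> c v)))"

definition is_submodule ::
  "(complex \<Rightarrow> 'v::ab_group_add \<Rightarrow> 'v) \<Rightarrow> 'b set \<Rightarrow> ('b \<Rightarrow> 'v \<Rightarrow> 'v) \<Rightarrow> 'v set \<Rightarrow> bool" where
  "is_submodule sm B \<rho> S \<longleftrightarrow> module.subspace sm S \<and> (\<forall>b\<in>B. \<rho> b ` S \<subseteq> S)"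

definition irreducible_mod ::
  "(complex \<Rightarrow> 'v::ab_group_add \<Rightarrow> 'v) \<Rightarrow> 'b set \<Rightarrow> ('b \<Rightarrow> 'v \<Rightarrow> 'v) \<Rightarrow> bool" where
  "irreducible_mod sm B \<rho> \<longleftrightarrow>
     (UNIV :: 'v set) \<noteq> {0} \<and>
     (\<forall>S. is_submodule sm B \<rho> S \<longrightarrow> S = {0} \<or> S = UNIV)"

definition generated_submod ::
  "(complex \<Rightarrow> 'v::ab_group_add \<Rightarrow> 'v) \<Rightarrow> 'b set \<Rightarrow> ('b \<Rightarrow> 'v \<Rightarrow> 'v) \<Rightarrow> 'v \<Rightarrow> 'v set" where
  "generated_submod sm B \<rho> w = \<Inter> {S. is_submodule sm B \<rho> S \<and> w \<in> S}"

text \<open>A linear functional on the ideal \<open>\<frak>p\<close> (spanned by the basis part \<open>Bp\<close>) is given by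
its values on \<open>Bp\<close>; it is a Lie algebra homomorphism iff it vanishes on all brackets of
basis elements of \<open>\<frak>p\<close> (these span \<open>[\<frak>p,\<frak>p]\<close>; since \<open>\<frak>p\<close> is an ideal, the brackets lie in
the span of \<open>Bp\<close>).\<close>
definition lie_hom_on_p :: "'b set \<Rightarrow> ('b \<Rightarrow> 'b \<Rightarrow> 'b \<Rightarrow> complex) \<Rightarrow> ('b \<Rightarrow> complex) \<Rightarrow> bool" where
  "lie_hom_on_p Bp br \<phi> \<longleftrightarrow> (\<forall>a\<in>Bp. \<forall>b\<in>Bp. (\<Sum>c\<in>Bp. br a b c * \<phi> c) = 0)"

definition nonzero_on :: "'b set \<Rightarrow> ('b \<Rightarrow> complex) \<Rightarrow> bool" where
  "nonzero_on Bp \<phi> \<longleftrightarrow> (\<exists>b\<in>Bp. \<phi> b \<noteq> 0)"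

definition whittaker_vecs ::
  "(complex \<Rightarrow> 'v::ab_group_add \<Rightarrow> 'v) \<Rightarrow> 'b set \<Rightarrow> ('b \<Rightarrow> 'v \<Rightarrow> 'v) \<Rightarrow> ('b \<Rightarrow> complex) \<Rightarrow> 'v set" where
  "whittaker_vecs sm Bp \<rho> \<phi> = {v. \<forall>b\<in>Bp. \<rho> b v = sm (\<phi> b) v}"

definition quasi_whittaker ::
  "(complex \<Rightarrow> 'v::ab_group_add \<Rightarrow> 'v) \<Rightarrow> 'b set \<Rightarrow> 'b set \<Rightarrow> ('b \<Rightarrow> 'v \<Rightarrow> 'v) \<Rightarrow> ('b \<Rightarrow> complex) \<Rightarrow> bool" where
  "quasi_whittaker sm B Bp \<rho> \<phi> \<longleftrightarrow>
     (\<exists>w\<in>whittaker_vecs sm Bp \<rho> \<phi>. generated_submod sm B \<rho> w = UNIV)"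

definition bland ::
  "(complex \<Rightarrow> 'v::ab_group_add \<Rightarrow> 'v) \<Rightarrow> 'b set \<Rightarrow> 'b set \<Rightarrow> ('b \<Rightarrow> 'v \<Rightarrow> 'v) \<Rightarrow> ('b \<Rightarrow> complex) \<Rightarrow> bool" where
  "bland sm B Bp \<rho> \<phi> \<longleftrightarrow>
     irreducible_mod sm B \<rho> \<and> vector_space.dim sm (whittaker_vecs sm Bp \<rho> \<phi>) = 1"

definition sc :: "complex \<Rightarrow> 'b \<Rightarrow> 'b \<Rightarrow> complex" where
  "sc k x = (\<lambda>c. if c = x then k else 0)"

section \<open>(a) Conformal Galilei algebra \<open>\<frak>g^{(\<ell>)}\<close>, parametrised by \<open>m = 2\<ell>\<close>\<close>

datatype cga = cE | cH | cF | cP nat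

definition cga_basis :: "nat \<Rightarrow> cga set" where
  "cga_basis m = {cE, cH, cF} \<union> cP ` {0..m}"

definition cga_p :: "nat \<Rightarrow> cga set" where
  "cga_p m = cP ` {0..m}"

fun cga_br :: "nat \<Rightarrow> cga \<Rightarrow> cga \<Rightarrow> cga \<Rightarrow> complex" where
  "cga_br m cH cE = sc 2 cE"
| "cga_br m cE cH = sc (-2) cE"
| "cga_br m cH cF = sc (-2) cF"
| "cga_br m cF cH = sc 2 cF"
| "cga_br m cE cF = sc 1 cH"
| "cga_br m cF cE = sc (-1) cH"
| "cga_br m cH (cP k) = sc (of_nat m - 2 * of_nat k) (cP k)"
| "cga_br m (cP k) cH = sc (2 * of_nat k - of_nat m) (cP k)"
| "cga_br m cE (cP k) = sc (of_nat k) (cP (k - 1))"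
| "cga_br m (cP k) cE = sc (- of_nat k) (cP (k - 1))"
| "cga_br m cF (cP k) = sc (of_nat m - of_nat k) (cP (Suc k))"
| "cga_br m (cP k) cF = sc (of_nat k - of_nat m) (cP (Suc k))"
| "cga_br m _ _ = (\<lambda>_. 0)"

datatype sch = sH | sE | sF | sX nat | sY nat | sZ

definition sch_basis :: "nat \<Rightarrow> sch set" where
  "sch_basis n = {sH, sE, sF, sZ} \<union> sX ` {1..n} \<union> sY ` {1..n}"

definition sch_p :: "nat \<Rightarrow> sch set" where
  "sch_p n = {sZ} \<union> sX ` {1..n} \<union> sY ` {1..n}"

fun sch_br :: "sch \<Rightarrow> sch \<Rightarrow> sch \<Rightarrow> complex" where
  "sch_br sH sE = sc 2 sE"
| "sch_br sE sH = sc (-2) sE"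
| "sch_br sH sF = sc (-2) sF"
| "sch_br sF sH = sc 2 sF"
| "sch_br sE sF = sc 1 sH"
| "sch_br sF sE = sc (-1) sH"
| "sch_br sH (sX i) = sc 1 (sX i)"
| "sch_br (sX i) sH = sc (-1) (sX i)"
| "sch_br sF (sX i) = sc 1 (sY i)"
| "sch_br (sX i) sF = sc (-1) (sY i)"
| "sch_br sH (sY i) = sc (-1) (sY i)"
| "sch_br (sY i) sH = sc 1 (sY i)"
| "sch_br sE (sY i) = sc 1 (sX i)"
| "sch_br (sY i) sE = sc (-1) (sX i)"
| "sch_br (sX i) (sY j) = (if i = j then sc 1 sZ else (\<lambda>_. 0))"
| "sch_br (sY j) (sX i) = (if i = j then sc (-1) sZ else (\<lambda>_. 0))"
| "sch_br _ _ = (\<lambda>_. 0)"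

end

theory Submission
  imports Defs "HOL-Computational_Algebra.Fundamental_Theorem_Algebra"
begin

text \<open>Write \<open>\<frak>g = \<frak>s \<oplus> \<frak>p\<close> with \<open>\<frak>s = span {e, h, f}\<close>, and let \<open>0 \<noteq> w \<in> V\<^sub>\<phi>\<close>. Fix \<open>y \<in> \<frak>s \<inter> \<frak>g\<^sup>\<phi>\<close>
  (possibly \<open>y = 0\<close>) and filter \<open>V\<close> by \<open>M\<^sub>0 = \<complex>[y] w\<close>, \<open>M\<^sub>d\<^sub>+\<^sub>1 = M\<^sub>d + \<frak>s M\<^sub>d\<close>; by irreducibility
  \<open>\<Union> M\<^sub>d = V\<close>. Each \<open>p - \<phi>(p)\<close>, \<open>p \<in> \<frak>p\<close>, lowers the filtration degree. In both families there
  are \<open>q\<^sub>1, q\<^sub>2 \<in> \<frak>p\<close> whose functionals \<open>r\<^sub>i = \<phi>([q\<^sub>i, -])\<close> on \<open>\<frak>s\<close> are linearly independent. Taking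
  \<open>y = r\<^sub>1 \<times> r\<^sub>2\<close> if this lies in \<open>\<frak>g\<^sup>\<phi>\<close> and \<open>y = 0\<close> otherwise, the adjugate of a suitable \<open>3 \<times> 3\<close> matrix
  with rows \<open>r\<^sub>1, r\<^sub>2, \<dots>\<close> yields \<open>E = \<Sum> u\<^sub>i (q\<^sub>i - \<phi>(q\<^sub>i))\<close> with \<open>u\<^sub>i \<in> \<frak>s\<close> acting as \<open>d\<close> on
  \<open>M\<^sub>d / M\<^sub>d\<^sub>-\<^sub>1\<close>. As \<open>E\<close> kills \<open>V\<^sub>\<phi>\<close>, this gives \<open>V\<^sub>\<phi> \<subseteq> M\<^sub>0 = \<complex>[y] w\<close> for every such \<open>w\<close>. Since \<open>y\<close>
  preserves \<open>V\<^sub>\<phi>\<close>, the fundamental theorem of algebra provides an eigenvector \<open>u\<close> of \<open>y\<close> in \<open>V\<^sub>\<phi>\<close>,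
  and then \<open>V\<^sub>\<phi> \<subseteq> \<complex>[y] u = \<complex> u\<close>.\<close>

section \<open>Polynomials in a linear operator\<close>

definition poly_act :: "('a::comm_ring_1 \<Rightarrow> 'v::ab_group_add \<Rightarrow> 'v) \<Rightarrow> ('v \<Rightarrow> 'v) \<Rightarrow> 'a poly \<Rightarrow> 'v \<Rightarrow> 'v"
  where "poly_act sm T g u = (\<Sum>k\<le>degree g. sm (coeff g k) ((T ^^ k) u))"

context
  fixes sm :: "'a::comm_ring_1 \<Rightarrow> 'v::ab_group_add \<Rightarrow> 'v" and T :: "'v \<Rightarrow> 'v"
  assumes T: "module_hom sm sm T"
begin

interpretation module sm
  using T by (simp add: module_hom_def)

lemma poly_act_degree_bound:
  assumes "degree g \<le> N"
  shows "poly_act sm T g u = (\<Sum>k\<le>N. sm (coeff g k) ((T ^^ k) u))"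
proof -
  have "(\<Sum>k\<in>{..N} - {..degree g}. sm (coeff g k) ((T ^^ k) u)) = 0"
    by (intro sum.neutral) (auto simp: coeff_eq_0)
  then show ?thesis
    using assms unfolding poly_act_def by (simp add: sum.subset_diff[of "{..degree g}" "{..N}"])
qed

lemma poly_act_0 [simp]: "poly_act sm T 0 u = 0"
  by (simp add: poly_act_def)

lemma poly_act_const [simp]: "poly_act sm T [:c:] u = sm c u"
  by (simp add: poly_act_def)

lemma poly_act_add: "poly_act sm T (g + h) u = poly_act sm T g u + poly_act sm T h u"
proof -
  define N where "N = max (degree g) (degree h)"
  have "degree (g + h) \<le> N"
    unfolding N_def by (rule degree_add_le) auto
  then show ?thesis
    using poly_act_degree_bound[of "g + h" N] poly_act_degree_bound[of g N] poly_act_degree_bound[of h N]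
    by (simp add: N_def scale_left_distrib sum.distrib)
qed

lemma poly_act_smult: "poly_act sm T (smult c g) u = sm c (poly_act sm T g u)"
  using poly_act_degree_bound[of "smult c g" "degree g"]
  by (simp add: poly_act_def scale_sum_right degree_smult_le)

lemma poly_act_pCons: "poly_act sm T (pCons a g) u = sm a u + T (poly_act sm T g u)"
proof -
  have "poly_act sm T (pCons 0 g) u = (\<Sum>k\<le>Suc (degree g). sm (coeff (pCons 0 g) k) ((T ^^ k) u))"
    by (rule poly_act_degree_bound) (simp add: degree_pCons_le)
  also have "\<dots> = (\<Sum>k\<le>degree g. sm (coeff g k) ((T ^^ Suc k) u))"
    by (subst sum.atMost_Suc_shift) simp
  also have "\<dots> = T (poly_act sm T g u)"
    by (simp add: poly_act_def module_hom.sum[OF T] module_hom.scale[OF T])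
  finally have "poly_act sm T (pCons 0 g) u = T (poly_act sm T g u)" .
  moreover have "pCons a g = [:a:] + pCons 0 g"
    by simp
  ultimately show ?thesis
    by (metis poly_act_add poly_act_const)
qed

lemma poly_act_comm: "poly_act sm T g (T u) = T (poly_act sm T g u)"
  by (simp add: poly_act_def module_hom.sum[OF T] module_hom.scale[OF T] funpow_swap1)

lemma poly_act_eigenvector:
  assumes "T u = sm c u"
  shows "poly_act sm T g u = sm (poly g c) u"
  by (induction g) (auto simp: poly_act_pCons assms module_hom.scale[OF T] scale_left_distrib mult.commute)

lemma poly_act_linear_factor:
  "poly_act sm T ([:- z, 1:] * h) u = T (poly_act sm T h u) - sm z (poly_act sm T h u)"
proof -
  have "[:- z, 1:] * h = smult (- z) h + pCons 0 h"
    by (simp add: mult_pCons_left one_pCons[symmetric])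
  then show ?thesis
    by (simp only: poly_act_add poly_act_smult poly_act_pCons scale_minus_left scale_zero_left) simp
qed

lemma poly_act_in_subspace:
  assumes "subspace W" "T ` W \<subseteq> W" "u \<in> W"
  shows "poly_act sm T g u \<in> W"
  by (induction g) (use assms in \<open>auto simp: poly_act_pCons subspace_0 intro!: subspace_add subspace_scale\<close>)

end

lemma complex_poly_linear_factor:
  fixes g :: "complex poly"
  assumes "degree g \<noteq> 0"
  obtains z h where "g = [:- z, 1:] * h" "h \<noteq> 0" "degree h < degree g"
proof -
  have "\<not> constant (poly g)"
    using assms by (simp add: constant_degree)
  then obtain z where "poly g z = 0"
    using fundamental_theorem_of_algebra by blast
  then have "[:- z, 1:] dvd g"
    by (simp add: dvd_iff_poly_eq_0)
  then obtain h where gh: "g = [:- z, 1:] * h"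
    by (elim dvdE)
  then have "h \<noteq> 0"
    using assms by auto
  have "degree g = degree [:- z, 1:] + degree h"
    unfolding gh by (rule degree_mult_eq) (use \<open>h \<noteq> 0\<close> in auto)
  then show ?thesis
    using that gh \<open>h \<noteq> 0\<close> by simp
qed

lemma exists_eigenvector_in_invariant_subspace:
  fixes sm :: "complex \<Rightarrow> 'v::ab_group_add \<Rightarrow> 'v"
  assumes T: "module_hom sm sm T" and W: "module.subspace sm W" "T ` W \<subseteq> W"
    and u: "u \<in> W" "u \<noteq> 0" and g: "g \<noteq> 0" "poly_act sm T g u = 0"
  shows "\<exists>v\<in>W. v \<noteq> 0 \<and> (\<exists>c. T v = sm c v)"
  using u g
proof (induction "degree g" arbitrary: g rule: less_induct)
  case less
  interpret vector_space sm
    using T by (simp add: module_hom_def vector_space_def module_def)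
  show ?case
  proof (cases "degree g = 0")
    case True
    then obtain c where "g = [:c:]" "c \<noteq> 0"
      using less.prems(3) by (metis degree_eq_zeroE pCons_0_0)
    then show ?thesis
      using less.prems by (simp add: poly_act_const[OF T])
  next
    case False
    then obtain z h where gh: "g = [:- z, 1:] * h" and "h \<noteq> 0" and deg: "degree h < degree g"
      by (rule complex_poly_linear_factor)
    have "poly_act sm T g u = T (poly_act sm T h u) - sm z (poly_act sm T h u)"
      unfolding gh by (rule poly_act_linear_factor[OF T])
    moreover have "poly_act sm T h u \<in> W"
      by (rule poly_act_in_subspace[OF T W u(1)])
    ultimately show ?thesis
      using less.hyps[OF deg _ _ \<open>h \<noteq> 0\<close>] less.prems by (cases "poly_act sm T h u = 0") auto
  qed
qed

section \<open>Representations of a semidirect sum \<open>\<frak>s \<oplus> \<frak>p\<close>\<close>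

text \<open>Elements of \<open>\<frak>s\<close> and \<open>\<frak>p\<close> are given by coordinate functions: \<open>s_act u\<close> is the action of
  \<open>\<Sum> u b \<cdot> b \<in> \<frak>s\<close>, \<open>p_dev l\<close> that of \<open>l - \<phi>(l)\<close> for \<open>l \<in> \<frak>p\<close>, and \<open>phi_br q a = \<phi>([q, a])\<close>.\<close>

locale semidirect_rep = vector_space sm for sm :: "complex \<Rightarrow> 'v::ab_group_add \<Rightarrow> 'v" +
  fixes B Bs Bp :: "'b set" and br :: "'b \<Rightarrow> 'b \<Rightarrow> 'b \<Rightarrow> complex"
    and \<rho> :: "'b \<Rightarrow> 'v \<Rightarrow> 'v" and \<phi> :: "'b \<Rightarrow> complex"
  assumes finite_basis: "finite B"
    and basis_split: "B = Bs \<union> Bp" and basis_disjoint: "Bs \<inter> Bp = {}"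
    and linear_rho: "\<forall>b\<in>B. Vector_Spaces.linear sm sm (\<rho> b)"
    and rho_bracket: "\<forall>a\<in>B. \<forall>b\<in>B. \<forall>v. \<rho> a (\<rho> b v) - \<rho> b (\<rho> a v) = (\<Sum>c\<in>B. sm (br a b c) (\<rho> c v))"
    and p_ideal: "\<forall>a\<in>B. \<forall>b\<in>Bp. \<forall>c\<in>Bs. br a b c = 0 \<and> br b a c = 0"
    and s_subalgebra: "\<forall>a\<in>Bs. \<forall>b\<in>Bs. \<forall>c\<in>Bp. br a b c = 0"
begin

abbreviation V\<^sub>\<phi> :: "'v set" where
  "V\<^sub>\<phi> \<equiv> whittaker_vecs sm Bp \<rho> \<phi>"

definition s_act :: "('b \<Rightarrow> complex) \<Rightarrow> 'v \<Rightarrow> 'v" where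
  "s_act u v = (\<Sum>b\<in>Bs. sm (u b) (\<rho> b v))"

definition p_dev :: "('b \<Rightarrow> complex) \<Rightarrow> 'v \<Rightarrow> 'v" where
  "p_dev l v = (\<Sum>c\<in>Bp. sm (l c) (\<rho> c v - sm (\<phi> c) v))"

definition phi_br :: "'b \<Rightarrow> 'b \<Rightarrow> complex" where
  "phi_br q a = (\<Sum>k\<in>Bp. br q a k * \<phi> k)"

lemma finite_Bs: "finite Bs" and finite_Bp: "finite Bp"
  using finite_basis basis_split by auto

lemma hom_rho: "b \<in> B \<Longrightarrow> module_hom sm sm (\<rho> b)"
  using linear_rho by (simp add: module_hom_iff_linear)

lemmas rho_add = module_hom.add[OF hom_rho] and rho_scale = module_hom.scale[OF hom_rho]
  and rho_diff = module_hom.diff[OF hom_rho] and rho_sum = module_hom.sum[OF hom_rho]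
  and rho_0 = module_hom.zero[OF hom_rho]

lemma hom_s_act: "module_hom sm sm (s_act u)"
  unfolding module_hom_iff s_act_def using basis_split
  by (auto simp: module_axioms rho_add rho_scale scale_sum_right algebra_simps sum.distrib
      intro!: sum.cong)

lemma hom_p_dev: "module_hom sm sm (p_dev l)"
proof (unfold module_hom_iff, intro conjI allI module_axioms)
  show "p_dev l (x + y) = p_dev l x + p_dev l y" for x y
    unfolding p_dev_def sum.distrib[symmetric] using basis_split
    by (intro sum.cong) (auto simp: rho_add algebra_simps)
  show "p_dev l (sm c x) = sm c (p_dev l x)" for c x
    unfolding p_dev_def using basis_split
    by (auto simp: rho_scale scale_sum_right algebra_simps intro!: sum.cong)
qed

lemmas s_act_add = module_hom.add[OF hom_s_act] and s_act_scale = module_hom.scale[OF hom_s_act]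
  and s_act_sum = module_hom.sum[OF hom_s_act] and s_act_0 = module_hom.zero[OF hom_s_act]

lemmas p_dev_add = module_hom.add[OF hom_p_dev] and p_dev_scale = module_hom.scale[OF hom_p_dev]
  and p_dev_sum = module_hom.sum[OF hom_p_dev]

lemma p_dev_basis:
  assumes "q \<in> Bp"
  shows "p_dev (sc 1 q) x = \<rho> q x - sm (\<phi> q) x"
proof -
  have "p_dev (sc 1 q) x = (\<Sum>c\<in>Bp. if c = q then \<rho> c x - sm (\<phi> c) x else 0)"
    unfolding p_dev_def sc_def by (intro sum.cong) auto
  then show ?thesis
    using assms finite_Bp by simp
qed

lemma subspace_whittaker_vecs: "subspace V\<^sub>\<phi>"
  unfolding subspace_def whittaker_vecs_def using basis_split
  by (auto simp: rho_0 rho_add rho_scale scale_right_distrib scale_left_commute)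

lemma p_dev_whittaker: "v \<in> V\<^sub>\<phi> \<Longrightarrow> p_dev l v = 0"
  unfolding p_dev_def whittaker_vecs_def by simp

lemma rho_p_s_comm:
  assumes c: "c \<in> Bp" and a: "a \<in> Bs"
  shows "\<rho> c (\<rho> a v) = \<rho> a (\<rho> c v) + (\<Sum>k\<in>Bp. sm (br c a k) (\<rho> k v))"
proof -
  have "\<rho> c (\<rho> a v) - \<rho> a (\<rho> c v) = (\<Sum>k\<in>B. sm (br c a k) (\<rho> k v))"
    using rho_bracket c a basis_split by auto
  also have "\<dots> = (\<Sum>k\<in>Bs. sm (br c a k) (\<rho> k v)) + (\<Sum>k\<in>Bp. sm (br c a k) (\<rho> k v))"
    using basis_split basis_disjoint finite_Bs finite_Bp by (simp add: sum.union_disjoint)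
  also have "(\<Sum>k\<in>Bs. sm (br c a k) (\<rho> k v)) = 0"
    using p_ideal c a basis_split by (intro sum.neutral) auto
  finally show ?thesis
    by (simp add: algebra_simps)
qed

lemma rho_s_s_comm:
  assumes b: "b \<in> Bs" and a: "a \<in> Bs"
  shows "\<rho> b (\<rho> a v) = \<rho> a (\<rho> b v) + (\<Sum>k\<in>Bs. sm (br b a k) (\<rho> k v))"
proof -
  have "\<rho> b (\<rho> a v) - \<rho> a (\<rho> b v) = (\<Sum>k\<in>B. sm (br b a k) (\<rho> k v))"
    using rho_bracket b a basis_split by auto
  also have "\<dots> = (\<Sum>k\<in>Bs. sm (br b a k) (\<rho> k v)) + (\<Sum>k\<in>Bp. sm (br b a k) (\<rho> k v))"
    using basis_split basis_disjoint finite_Bs finite_Bp by (simp add: sum.union_disjoint)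
  also have "(\<Sum>k\<in>Bp. sm (br b a k) (\<rho> k v)) = 0"
    using s_subalgebra b a by (intro sum.neutral) auto
  finally show ?thesis
    by (simp add: algebra_simps)
qed

lemma s_act_rho_comm:
  assumes a: "a \<in> Bs"
  shows "s_act u (\<rho> a v) = \<rho> a (s_act u v) + s_act (\<lambda>k. \<Sum>b\<in>Bs. u b * br b a k) v"
proof -
  have "s_act u (\<rho> a v) = (\<Sum>b\<in>Bs. sm (u b) (\<rho> a (\<rho> b v))) + (\<Sum>b\<in>Bs. \<Sum>k\<in>Bs. sm (u b * br b a k) (\<rho> k v))"
    unfolding s_act_def using rho_s_s_comm[OF _ a]
    by (simp add: sum.distrib scale_right_distrib scale_sum_right)
  also have "(\<Sum>b\<in>Bs. sm (u b) (\<rho> a (\<rho> b v))) = \<rho> a (s_act u v)"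
    unfolding s_act_def using a basis_split by (simp add: rho_sum rho_scale)
  also have "(\<Sum>b\<in>Bs. \<Sum>k\<in>Bs. sm (u b * br b a k) (\<rho> k v)) = s_act (\<lambda>k. \<Sum>b\<in>Bs. u b * br b a k) v"
    unfolding s_act_def by (subst sum.swap) (simp add: scale_sum_left)
  finally show ?thesis .
qed

lemma p_dev_rho_comm:
  assumes a: "a \<in> Bs"
  shows "p_dev l (\<rho> a v) = \<rho> a (p_dev l v) + sm (\<Sum>c\<in>Bp. l c * phi_br c a) v
           + p_dev (\<lambda>k. \<Sum>c\<in>Bp. l c * br c a k) v"
proof -
  have aB: "a \<in> B"
    using a basis_split by auto
  have "p_dev l (\<rho> a v) = (\<Sum>c\<in>Bp. sm (l c) (\<rho> a (\<rho> c v) - sm (\<phi> c) (\<rho> a v))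
      + sm (l c) (\<Sum>k\<in>Bp. sm (br c a k) (\<rho> k v)))"
    unfolding p_dev_def using rho_p_s_comm[OF _ a] by (intro sum.cong) (auto simp: algebra_simps)
  also have "\<dots> = \<rho> a (p_dev l v) + (\<Sum>c\<in>Bp. \<Sum>k\<in>Bp. sm (l c * br c a k) (\<rho> k v))"
    unfolding p_dev_def using aB by (simp add: sum.distrib rho_sum rho_scale rho_diff scale_sum_right)
  also have "(\<Sum>c\<in>Bp. \<Sum>k\<in>Bp. sm (l c * br c a k) (\<rho> k v))
      = (\<Sum>c\<in>Bp. \<Sum>k\<in>Bp. sm (l c * br c a k * \<phi> k) v)
        + (\<Sum>c\<in>Bp. \<Sum>k\<in>Bp. sm (l c * br c a k) (\<rho> k v - sm (\<phi> k) v))"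
    by (simp add: sum.distrib[symmetric] algebra_simps)
  also have "(\<Sum>c\<in>Bp. \<Sum>k\<in>Bp. sm (l c * br c a k * \<phi> k) v) = sm (\<Sum>c\<in>Bp. l c * phi_br c a) v"
    unfolding phi_br_def by (simp add: scale_sum_left sum_distrib_left mult.assoc)
  also have "(\<Sum>c\<in>Bp. \<Sum>k\<in>Bp. sm (l c * br c a k) (\<rho> k v - sm (\<phi> k) v))
      = p_dev (\<lambda>k. \<Sum>c\<in>Bp. l c * br c a k) v"
    unfolding p_dev_def by (subst sum.swap) (simp add: scale_sum_left)
  finally show ?thesis
    by (simp add: add.assoc)
qed

text \<open>If the matrix \<open>(\<phi>([l\<^sub>i, a]))\<^sub>a\<^sub>,\<^sub>i\<close> has the right inverse \<open>(u\<^sub>i b)\<^sub>i\<^sub>,\<^sub>b\<close> modulo multiples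
  of \<open>y\<close>, then \<open>E = \<Sum>\<^sub>i u\<^sub>i (l\<^sub>i - \<phi>(l\<^sub>i))\<close> acts on \<open>M\<^sub>d / M\<^sub>d\<^sub>-\<^sub>1\<close> as the scalar \<open>d\<close>, where \<open>M\<close> is the
  filtration below.\<close>

definition degree_op :: "'i set \<Rightarrow> ('i \<Rightarrow> 'b \<Rightarrow> complex) \<Rightarrow> ('i \<Rightarrow> 'b \<Rightarrow> complex) \<Rightarrow> 'v \<Rightarrow> 'v" where
  "degree_op I ls us x = (\<Sum>i\<in>I. s_act (us i) (p_dev (ls i) x))"

definition is_degree_op :: "('b \<Rightarrow> complex) \<Rightarrow> 'i set \<Rightarrow> ('i \<Rightarrow> 'b \<Rightarrow> complex) \<Rightarrow> ('i \<Rightarrow> 'b \<Rightarrow> complex) \<Rightarrow> bool" where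
  "is_degree_op y I ls us \<longleftrightarrow>
     (\<forall>a\<in>Bs. \<exists>\<kappa>. \<forall>b\<in>Bs. (\<Sum>i\<in>I. (\<Sum>c\<in>Bp. ls i c * phi_br c a) * us i b) = (if b = a then 1 else 0) + \<kappa> * y b)"

lemma hom_degree_op: "module_hom sm sm (degree_op I ls us)"
  unfolding module_hom_iff degree_op_def
  by (simp add: module_axioms p_dev_add p_dev_scale s_act_add s_act_scale sum.distrib scale_sum_right)

lemmas degree_op_add = module_hom.add[OF hom_degree_op]
  and degree_op_sum = module_hom.sum[OF hom_degree_op]

lemma degree_op_whittaker: "x \<in> V\<^sub>\<phi> \<Longrightarrow> degree_op I ls us x = 0"
  unfolding degree_op_def by (simp add: p_dev_whittaker s_act_0)

lemma is_degree_opD: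
  assumes "is_degree_op y I ls us" and a: "a \<in> Bs"
  obtains \<kappa> where "\<And>u. (\<Sum>i\<in>I. sm (\<Sum>c\<in>Bp. ls i c * phi_br c a) (s_act (us i) u)) = \<rho> a u + sm \<kappa> (s_act y u)"
proof -
  obtain \<kappa> where co: "\<forall>b\<in>Bs. (\<Sum>i\<in>I. (\<Sum>c\<in>Bp. ls i c * phi_br c a) * us i b) = (if b = a then 1 else 0) + \<kappa> * y b"
    using assms unfolding is_degree_op_def by blast
  have "(\<Sum>i\<in>I. sm (\<Sum>c\<in>Bp. ls i c * phi_br c a) (s_act (us i) u)) = \<rho> a u + sm \<kappa> (s_act y u)" for u
  proof -
    have "(\<Sum>i\<in>I. sm (\<Sum>c\<in>Bp. ls i c * phi_br c a) (s_act (us i) u))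
        = (\<Sum>b\<in>Bs. sm (\<Sum>i\<in>I. (\<Sum>c\<in>Bp. ls i c * phi_br c a) * us i b) (\<rho> b u))"
      unfolding s_act_def by (simp add: scale_sum_right scale_sum_left sum.swap[of _ I])
    also have "\<dots> = (\<Sum>b\<in>Bs. sm (if b = a then 1 else 0) (\<rho> b u) + sm (\<kappa> * y b) (\<rho> b u))"
      using co by (intro sum.cong) (auto simp: scale_left_distrib)
    also have "\<dots> = \<rho> a u + sm \<kappa> (s_act y u)"
      unfolding s_act_def sum.distrib using a finite_Bs
      by (simp add: scale_sum_right if_distrib[of "\<lambda>t. sm t _"] cong: if_cong)
    finally show ?thesis .
  qed
  then show thesis
    by (rule that)
qed

end

section \<open>The filtration generated by a Whittaker vector\<close>

text \<open>The assumption on \<open>y\<close> says \<open>y \<in> \<frak>g\<^sup>\<phi>\<close>.\<close>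

locale semidirect_rep_y = semidirect_rep +
  fixes y :: "'b \<Rightarrow> complex"
  assumes y_stabilizes_phi: "\<forall>c\<in>Bp. (\<Sum>b\<in>Bs. y b * phi_br c b) = 0"
begin

lemmas y_poly_act_add = poly_act_add[OF hom_s_act[of y]]
  and y_poly_act_smult = poly_act_smult[OF hom_s_act[of y]]
  and y_poly_act_pCons = poly_act_pCons[OF hom_s_act[of y]]
  and y_poly_act_const = poly_act_const[OF hom_s_act[of y]]
  and y_poly_act_0 = poly_act_0[OF hom_s_act[of y]]

lemma s_act_y_whittaker:
  assumes v: "v \<in> V\<^sub>\<phi>"
  shows "s_act y v \<in> V\<^sub>\<phi>"
proof -
  have "\<rho> c (s_act y v) = sm (\<phi> c) (s_act y v)" if c: "c \<in> Bp" for c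
  proof -
    have "\<rho> c (s_act y v) = (\<Sum>b\<in>Bs. sm (y b) (\<rho> b (\<rho> c v) + (\<Sum>k\<in>Bp. sm (br c b k) (\<rho> k v))))"
      unfolding s_act_def using c basis_split rho_p_s_comm[OF c] by (simp add: rho_sum rho_scale)
    also have "\<dots> = (\<Sum>b\<in>Bs. sm (y b) (sm (\<phi> c) (\<rho> b v) + sm (phi_br c b) v))"
      using v c basis_split unfolding whittaker_vecs_def phi_br_def
      by (intro sum.cong) (auto simp: rho_scale scale_sum_left)
    also have "\<dots> = sm (\<phi> c) (s_act y v) + sm (\<Sum>b\<in>Bs. y b * phi_br c b) v"
      unfolding s_act_def
      by (simp add: sum.distrib scale_right_distrib scale_sum_left scale_sum_right mult.commute)
    finally show ?thesis
      using y_stabilizes_phi c by simp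
  qed
  then show ?thesis
    unfolding whittaker_vecs_def by auto
qed

fun filtration where
  "filtration v0 0 = range (\<lambda>g. poly_act sm (s_act y) g v0)"
| "filtration v0 (Suc d) =
     {m + (\<Sum>a\<in>Bs. \<rho> a (f a)) | m f. m \<in> filtration v0 d \<and> (\<forall>a\<in>Bs. f a \<in> filtration v0 d)}"

lemma sum_rho_0: "(\<Sum>a\<in>Bs. \<rho> a 0) = 0"
  using basis_split by (intro sum.neutral) (auto simp: rho_0)

lemma subspace_filtration_0: "subspace (filtration v0 0)"
  unfolding subspace_def
proof (intro conjI ballI allI)
  show "0 \<in> filtration v0 0"
    by (auto intro!: image_eqI[of _ _ 0] simp: y_poly_act_0)
  show "x + x' \<in> filtration v0 0" if "x \<in> filtration v0 0" "x' \<in> filtration v0 0" for x x'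
    using that by (auto simp: y_poly_act_add[symmetric])
  show "sm c x \<in> filtration v0 0" if "x \<in> filtration v0 0" for c x
    using that by (auto simp: y_poly_act_smult[symmetric])
qed

lemma subspace_filtration_Suc:
  assumes M: "subspace (filtration v0 d)"
  shows "subspace (filtration v0 (Suc d))"
  unfolding subspace_def
proof (intro conjI ballI allI)
  show "0 \<in> filtration v0 (Suc d)"
    using subspace_0[OF M] sum_rho_0 by (auto intro!: exI[of _ 0] exI[of _ "\<lambda>_. 0"])
  show "x + x' \<in> filtration v0 (Suc d)"
    if hx: "x \<in> filtration v0 (Suc d)" and hx': "x' \<in> filtration v0 (Suc d)" for x x'
  proof -
    obtain m f where x: "x = m + (\<Sum>a\<in>Bs. \<rho> a (f a))" "m \<in> filtration v0 d" "\<forall>a\<in>Bs. f a \<in> filtration v0 d"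
      using hx by auto
    obtain m' f' where x': "x' = m' + (\<Sum>a\<in>Bs. \<rho> a (f' a))" "m' \<in> filtration v0 d" "\<forall>a\<in>Bs. f' a \<in> filtration v0 d"
      using hx' by auto
    have "x + x' = (m + m') + (\<Sum>a\<in>Bs. \<rho> a (f a + f' a))"
      using x x' basis_split by (simp add: rho_add sum.distrib algebra_simps)
    moreover have "m + m' \<in> filtration v0 d" "\<forall>a\<in>Bs. f a + f' a \<in> filtration v0 d"
      using x x' subspace_add[OF M] by auto
    ultimately show ?thesis
      by auto
  qed
  show "sm c x \<in> filtration v0 (Suc d)" if hx: "x \<in> filtration v0 (Suc d)" for c x
  proof -
    obtain m f where x: "x = m + (\<Sum>a\<in>Bs. \<rho> a (f a))" "m \<in> filtration v0 d" "\<forall>a\<in>Bs. f a \<in> filtration v0 d"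
      using hx by auto
    have "sm c x = sm c m + (\<Sum>a\<in>Bs. \<rho> a (sm c (f a)))"
      using x basis_split by (simp add: rho_scale scale_sum_right scale_right_distrib)
    moreover have "sm c m \<in> filtration v0 d" "\<forall>a\<in>Bs. sm c (f a) \<in> filtration v0 d"
      using x subspace_scale[OF M] by auto
    ultimately show ?thesis
      by auto
  qed
qed

lemma subspace_filtration: "subspace (filtration v0 d)"
  by (induction d) (blast intro: subspace_filtration_0 subspace_filtration_Suc)+

lemmas filtration_0 = subspace_0[OF subspace_filtration]
  and filtration_add = subspace_add[OF subspace_filtration]
  and filtration_diff = subspace_diff[OF subspace_filtration]
  and filtration_scale = subspace_scale[OF subspace_filtration]
  and filtration_sum = subspace_sum[OF subspace_filtration]

lemma filtration_Suc_mono: "x \<in> filtration v0 d \<Longrightarrow> x \<in> filtration v0 (Suc d)"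
  using filtration_0 sum_rho_0 by (auto intro!: exI[of _ x] exI[of _ "\<lambda>_. 0"])

lemma filtration_mono: "i \<le> j \<Longrightarrow> filtration v0 i \<subseteq> filtration v0 j"
  by (induction j rule: dec_induct) (use filtration_Suc_mono in auto)

lemma rho_filtration:
  assumes a: "a \<in> Bs" and x: "x \<in> filtration v0 d"
  shows "\<rho> a x \<in> filtration v0 (Suc d)"
proof -
  have "(\<Sum>b\<in>Bs. \<rho> b (if b = a then x else 0)) = \<rho> a x"
    using a finite_Bs basis_split by (simp add: if_distrib rho_0 cong: if_cong)
  moreover have "\<forall>b\<in>Bs. (if b = a then x else 0) \<in> filtration v0 d"
    using x filtration_0 by auto
  ultimately show ?thesis
    using filtration_0[of v0 d] by (auto intro!: exI[of _ 0] exI[of _ "\<lambda>b. if b = a then x else 0"])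
qed

lemma s_act_filtration: "x \<in> filtration v0 d \<Longrightarrow> s_act u x \<in> filtration v0 (Suc d)"
  unfolding s_act_def by (intro filtration_sum filtration_scale rho_filtration)

lemma s_act_y_filtration: "x \<in> filtration v0 d \<Longrightarrow> s_act y x \<in> filtration v0 d"
proof (induction d arbitrary: x)
  case 0
  then obtain g where "x = poly_act sm (s_act y) g v0"
    by auto
  moreover have "s_act y (poly_act sm (s_act y) g v0) = poly_act sm (s_act y) (pCons 0 g) v0"
    by (simp add: y_poly_act_pCons)
  ultimately show ?case
    by auto
next
  case (Suc d)
  then obtain m f where x: "x = m + (\<Sum>a\<in>Bs. \<rho> a (f a))" "m \<in> filtration v0 d" "\<forall>a\<in>Bs. f a \<in> filtration v0 d"
    by auto
  have "s_act y x = s_act y m + (\<Sum>a\<in>Bs. \<rho> a (s_act y (f a)) + s_act (\<lambda>k. \<Sum>b\<in>Bs. y b * br b a k) (f a))"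
    using x by (simp add: s_act_add s_act_sum s_act_rho_comm)
  also have "\<dots> \<in> filtration v0 (Suc d)"
    using x Suc.IH
    by (intro filtration_add filtration_sum filtration_Suc_mono rho_filtration s_act_filtration) auto
  finally show ?case .
qed

declare filtration.simps [simp del]

lemma filtration_0_iff: "x \<in> filtration v0 0 \<longleftrightarrow> (\<exists>g. x = poly_act sm (s_act y) g v0)"
  by (auto simp: filtration.simps)

lemma filtration_SucE:
  assumes "x \<in> filtration v0 (Suc d)"
  obtains m f where "x = m + (\<Sum>a\<in>Bs. \<rho> a (f a))" "m \<in> filtration v0 d" "\<forall>a\<in>Bs. f a \<in> filtration v0 d"
  using assms by (auto simp: filtration.simps)

lemma generator_in_filtration: "v0 \<in> filtration v0 0"
  using y_poly_act_const[of 1 v0] by (auto simp: filtration_0_iff intro!: exI[of _ "[:1:]"])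

lemma filtration_0_whittaker:
  assumes "v0 \<in> V\<^sub>\<phi>"
  shows "filtration v0 0 \<subseteq> V\<^sub>\<phi>"
proof -
  have "s_act y ` V\<^sub>\<phi> \<subseteq> V\<^sub>\<phi>"
    using s_act_y_whittaker by auto
  then show ?thesis
    using poly_act_in_subspace[OF hom_s_act subspace_whittaker_vecs _ assms] by (auto simp: filtration_0_iff)
qed

lemma p_dev_filtration_0: "v0 \<in> V\<^sub>\<phi> \<Longrightarrow> x \<in> filtration v0 0 \<Longrightarrow> p_dev l x = 0"
  using filtration_0_whittaker p_dev_whittaker by blast

lemma p_dev_rho_filtration_expand:
  assumes "x = m + (\<Sum>a\<in>Bs. \<rho> a (f a))"
  shows "p_dev l x = p_dev l m + (\<Sum>a\<in>Bs. \<rho> a (p_dev l (f a)) + sm (\<Sum>c\<in>Bp. l c * phi_br c a) (f a)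
           + p_dev (\<lambda>k. \<Sum>c\<in>Bp. l c * br c a k) (f a))"
  using assms by (simp add: p_dev_add p_dev_sum p_dev_rho_comm)

lemma p_dev_filtration_Suc:
  assumes v0: "v0 \<in> V\<^sub>\<phi>"
  shows "x \<in> filtration v0 (Suc d) \<Longrightarrow> p_dev l x \<in> filtration v0 d"
proof (induction d arbitrary: x l)
  case 0
  obtain m f where x: "x = m + (\<Sum>a\<in>Bs. \<rho> a (f a))" "m \<in> filtration v0 0" "\<forall>a\<in>Bs. f a \<in> filtration v0 0"
    using 0 by (rule filtration_SucE)
  have "p_dev l x = (\<Sum>a\<in>Bs. sm (\<Sum>c\<in>Bp. l c * phi_br c a) (f a))"
    using p_dev_rho_filtration_expand[OF x(1)] x p_dev_filtration_0[OF v0] basis_split by (simp add: rho_0)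
  also have "\<dots> \<in> filtration v0 0"
    using x by (intro filtration_sum filtration_scale) auto
  finally show ?case .
next
  case (Suc d)
  obtain m f where x: "x = m + (\<Sum>a\<in>Bs. \<rho> a (f a))"
      "m \<in> filtration v0 (Suc d)" "\<forall>a\<in>Bs. f a \<in> filtration v0 (Suc d)"
    using Suc.prems by (rule filtration_SucE)
  show ?case
    unfolding p_dev_rho_filtration_expand[OF x(1)]
  proof (intro filtration_add filtration_sum)
    show "p_dev l m \<in> filtration v0 (Suc d)"
      using x Suc.IH by (intro filtration_Suc_mono) auto
    fix a assume a: "a \<in> Bs"
    show "\<rho> a (p_dev l (f a)) \<in> filtration v0 (Suc d)"
      using x Suc.IH a by (intro rho_filtration) auto
    show "sm (\<Sum>c\<in>Bp. l c * phi_br c a) (f a) \<in> filtration v0 (Suc d)"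
      using x a by (intro filtration_scale) auto
    show "p_dev (\<lambda>k. \<Sum>c\<in>Bp. l c * br c a k) (f a) \<in> filtration v0 (Suc d)"
      using x Suc.IH a by (intro filtration_Suc_mono) auto
  qed
qed

lemma p_dev_filtration: "v0 \<in> V\<^sub>\<phi> \<Longrightarrow> x \<in> filtration v0 d \<Longrightarrow> p_dev l x \<in> filtration v0 d"
  by (cases d) (auto simp: p_dev_filtration_0 filtration_0 intro: filtration_Suc_mono p_dev_filtration_Suc)

lemma rho_filtration_basis:
  assumes v0: "v0 \<in> V\<^sub>\<phi>" and b: "b \<in> B" and x: "x \<in> filtration v0 d"
  shows "\<rho> b x \<in> filtration v0 (Suc d)"
proof (cases "b \<in> Bs")
  case True
  then show ?thesis
    using rho_filtration[OF True x] by blast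
next
  case False
  then have bp: "b \<in> Bp"
    using b basis_split by auto
  have "\<rho> b x = p_dev (sc 1 b) x + sm (\<phi> b) x"
    unfolding p_dev_basis[OF bp] by simp
  also have "\<dots> \<in> filtration v0 d"
    using x v0 by (intro filtration_add filtration_scale p_dev_filtration) auto
  finally show ?thesis
    by (rule filtration_Suc_mono)
qed

lemma subspace_filtration_Union: "subspace (\<Union>d. filtration v0 d)"
  unfolding subspace_def
proof (intro conjI ballI allI)
  show "0 \<in> (\<Union>d. filtration v0 d)"
    using filtration_0 by blast
  show "x + x' \<in> (\<Union>d. filtration v0 d)" if hx: "x \<in> (\<Union>d. filtration v0 d)" "x' \<in> (\<Union>d. filtration v0 d)"
    for x x'
  proof -
    obtain i j where "x \<in> filtration v0 i" "x' \<in> filtration v0 j"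
      using hx by auto
    then have "x \<in> filtration v0 (max i j)" "x' \<in> filtration v0 (max i j)"
      by (meson filtration_mono max.cobounded1 max.cobounded2 subsetD)+
    then show ?thesis
      using filtration_add by blast
  qed
  show "sm c x \<in> (\<Union>d. filtration v0 d)" if "x \<in> (\<Union>d. filtration v0 d)" for c x
    using that filtration_scale by blast
qed

lemma filtration_exhaustive:
  assumes v0: "v0 \<in> V\<^sub>\<phi>" "v0 \<noteq> 0" and irr: "irreducible_mod sm B \<rho>"
  shows "(\<Union>d. filtration v0 d) = UNIV"
proof -
  have "is_submodule sm B \<rho> (\<Union>d. filtration v0 d)"
    unfolding is_submodule_def using subspace_filtration_Union rho_filtration_basis[OF v0(1)] by blast
  then have "(\<Union>d. filtration v0 d) = {0} \<or> (\<Union>d. filtration v0 d) = UNIV"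
    using irr unfolding irreducible_mod_def by blast
  moreover have "v0 \<in> (\<Union>d. filtration v0 d)"
    using generator_in_filtration by blast
  ultimately show ?thesis
    using v0(2) by blast
qed

section \<open>The degree operator\<close>

lemma s_act_p_dev_filtration: "v0 \<in> V\<^sub>\<phi> \<Longrightarrow> x \<in> filtration v0 d \<Longrightarrow> s_act u (p_dev l x) \<in> filtration v0 d"
  by (cases d) (auto simp: p_dev_filtration_0 s_act_0 filtration_0 intro: s_act_filtration p_dev_filtration_Suc)

lemma degree_op_rho_comm:
  assumes v0: "v0 \<in> V\<^sub>\<phi>" and E: "is_degree_op y I ls us"
    and u: "u \<in> filtration v0 d" and a: "a \<in> Bs"
  shows "\<exists>R\<in>filtration v0 d. degree_op I ls us (\<rho> a u) = \<rho> a (degree_op I ls us u) + R + \<rho> a u"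
proof -
  obtain \<kappa> where \<kappa>: "\<And>u. (\<Sum>i\<in>I. sm (\<Sum>c\<in>Bp. ls i c * phi_br c a) (s_act (us i) u)) = \<rho> a u + sm \<kappa> (s_act y u)"
    using is_degree_opD[OF E a] by blast
  have aB: "a \<in> B"
    using a basis_split by auto
  define R where "R = (\<Sum>i\<in>I. s_act (\<lambda>k. \<Sum>b\<in>Bs. us i b * br b a k) (p_dev (ls i) u))
     + sm \<kappa> (s_act y u) + (\<Sum>i\<in>I. s_act (us i) (p_dev (\<lambda>k. \<Sum>c\<in>Bp. ls i c * br c a k) u))"
  have "degree_op I ls us (\<rho> a u) = (\<Sum>i\<in>I. \<rho> a (s_act (us i) (p_dev (ls i) u))
        + s_act (\<lambda>k. \<Sum>b\<in>Bs. us i b * br b a k) (p_dev (ls i) u)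
        + sm (\<Sum>c\<in>Bp. ls i c * phi_br c a) (s_act (us i) u)
        + s_act (us i) (p_dev (\<lambda>k. \<Sum>c\<in>Bp. ls i c * br c a k) u))"
    unfolding degree_op_def using a by (simp add: p_dev_rho_comm s_act_add s_act_scale s_act_rho_comm)
  also have "\<dots> = \<rho> a (degree_op I ls us u) + R + \<rho> a u"
    unfolding degree_op_def R_def using \<kappa> aB by (simp add: sum.distrib rho_sum algebra_simps)
  finally have "degree_op I ls us (\<rho> a u) = \<rho> a (degree_op I ls us u) + R + \<rho> a u" .
  moreover have "R \<in> filtration v0 d"
    unfolding R_def using u v0
    by (intro filtration_add filtration_sum filtration_scale s_act_p_dev_filtration s_act_y_filtration) auto
  ultimately show ?thesis
    by blast
qed

lemma degree_op_step:
  assumes v0: "v0 \<in> V\<^sub>\<phi>" and E: "is_degree_op y I ls us"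
    and H: "\<forall>u\<in>filtration v0 d. degree_op I ls us u - sm (of_nat d) u \<in> filtration v0 d
              \<and> (\<forall>a\<in>Bs. \<rho> a (degree_op I ls us u - sm (of_nat d) u) \<in> filtration v0 d)"
    and x: "x \<in> filtration v0 (Suc d)"
  shows "degree_op I ls us x - sm (of_nat (Suc d)) x \<in> filtration v0 d"
proof -
  let ?E = "degree_op I ls us"
  obtain m f where x: "x = m + (\<Sum>a\<in>Bs. \<rho> a (f a))" "m \<in> filtration v0 d" "\<forall>a\<in>Bs. f a \<in> filtration v0 d"
    using x by (rule filtration_SucE)
  have "\<forall>a\<in>Bs. \<exists>R\<in>filtration v0 d. ?E (\<rho> a (f a)) = \<rho> a (?E (f a)) + R + \<rho> a (f a)"
    using degree_op_rho_comm[OF v0 E] x by blast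
  then obtain R where R: "\<forall>a\<in>Bs. R a \<in> filtration v0 d \<and> ?E (\<rho> a (f a)) = \<rho> a (?E (f a)) + R a + \<rho> a (f a)"
    by metis
  have "?E x - sm (of_nat (Suc d)) x = ?E m - sm (of_nat (Suc d)) m
      + (\<Sum>a\<in>Bs. ?E (\<rho> a (f a)) - sm (of_nat (Suc d)) (\<rho> a (f a)))"
    using x by (simp add: degree_op_add degree_op_sum scale_right_distrib scale_sum_right sum_subtractf)
  also have "(\<Sum>a\<in>Bs. ?E (\<rho> a (f a)) - sm (of_nat (Suc d)) (\<rho> a (f a)))
      = (\<Sum>a\<in>Bs. \<rho> a (?E (f a) - sm (of_nat d) (f a)) + R a)"
    using R basis_split by (intro sum.cong) (auto simp: rho_diff rho_scale scale_left_distrib algebra_simps)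
  finally have "?E x - sm (of_nat (Suc d)) x
      = (?E m - sm (of_nat d) m) - m + (\<Sum>a\<in>Bs. \<rho> a (?E (f a) - sm (of_nat d) (f a)) + R a)"
    by (simp add: scale_left_distrib algebra_simps)
  also have "\<dots> \<in> filtration v0 d"
  proof (rule filtration_add[OF filtration_diff])
    show "?E m - sm (of_nat d) m \<in> filtration v0 d" "m \<in> filtration v0 d"
      using H x by auto
    show "(\<Sum>a\<in>Bs. \<rho> a (?E (f a) - sm (of_nat d) (f a)) + R a) \<in> filtration v0 d"
      using H x R by (intro filtration_sum filtration_add) auto
  qed
  finally show ?thesis .
qed

lemma degree_op_shift:
  assumes v0: "v0 \<in> V\<^sub>\<phi>" and E: "is_degree_op y I ls us"
  shows "x \<in> filtration v0 (Suc d) \<Longrightarrow> degree_op I ls us x - sm (of_nat (Suc d)) x \<in> filtration v0 d"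
proof (induction d arbitrary: x)
  case 0
  have "degree_op I ls us u = 0" if "u \<in> filtration v0 0" for u
    using that filtration_0_whittaker[OF v0] degree_op_whittaker by blast
  then show ?case
    using degree_op_step[OF v0 E _ 0] basis_split by (auto simp: rho_0 filtration_0)
next
  case (Suc d)
  then show ?case
    using degree_op_step[OF v0 E _ Suc.prems] by (auto intro: filtration_Suc_mono rho_filtration)
qed

lemma whittaker_in_filtration_0:
  assumes v0: "v0 \<in> V\<^sub>\<phi>" and E: "is_degree_op y I ls us" and x: "x \<in> V\<^sub>\<phi>"
  shows "x \<in> filtration v0 d \<Longrightarrow> x \<in> filtration v0 0"
proof (induction d)
  case (Suc d)
  have "- sm (of_nat (Suc d)) x \<in> filtration v0 d"
    using degree_op_shift[OF v0 E Suc.prems] degree_op_whittaker[OF x, of I ls us] by simp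
  then have "sm (- 1 / of_nat (Suc d)) (- sm (of_nat (Suc d)) x) \<in> filtration v0 d"
    by (rule filtration_scale)
  then show ?case
    using Suc.IH by (simp add: scale_minus_right del: of_nat_Suc)
qed

lemma whittaker_subset_filtration_0:
  assumes v0: "v0 \<in> V\<^sub>\<phi>" "v0 \<noteq> 0" and irr: "irreducible_mod sm B \<rho>"
    and E: "is_degree_op y I ls us"
  shows "V\<^sub>\<phi> \<subseteq> filtration v0 0"
proof
  fix x assume x: "x \<in> V\<^sub>\<phi>"
  obtain d where "x \<in> filtration v0 d"
    using filtration_exhaustive[OF v0 irr] by blast
  then show "x \<in> filtration v0 0"
    using whittaker_in_filtration_0[OF v0(1) E x] by blast
qed

lemma whittaker_eigenvector:
  assumes w: "w \<in> V\<^sub>\<phi>" "w \<noteq> 0"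
    and cyclic: "\<And>v. v \<in> V\<^sub>\<phi> \<Longrightarrow> v \<noteq> 0 \<Longrightarrow> V\<^sub>\<phi> \<subseteq> filtration v 0"
  obtains u c where "u \<in> V\<^sub>\<phi>" "u \<noteq> 0" "s_act y u = sm c u"
proof (cases "s_act y w = 0")
  case True
  then show ?thesis
    using that[of w 0] w by simp
next
  case False
  have yw: "s_act y w \<in> V\<^sub>\<phi>"
    by (rule s_act_y_whittaker[OF w(1)])
  have "w \<in> filtration (s_act y w) 0"
    using cyclic[OF yw False] w(1) by blast
  then obtain g where "w = poly_act sm (s_act y) g (s_act y w)"
    unfolding filtration_0_iff by blast
  then have "w = poly_act sm (s_act y) (pCons 0 g) w"
    by (simp add: poly_act_comm[OF hom_s_act] y_poly_act_pCons)
  moreover have "w = poly_act sm (s_act y) (1 - pCons 0 g) w + poly_act sm (s_act y) (pCons 0 g) w"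
    using y_poly_act_const[of 1 w] by (simp add: y_poly_act_add[symmetric] one_pCons)
  ultimately have "poly_act sm (s_act y) (1 - pCons 0 g) w = 0"
    by (metis add_cancel_left_left)
  moreover have "1 - pCons 0 g \<noteq> 0"
  proof
    assume "1 - pCons 0 g = 0"
    then have "coeff (1 - pCons 0 g) 0 = 0"
      by simp
    then show False
      by simp
  qed
  moreover have "s_act y ` V\<^sub>\<phi> \<subseteq> V\<^sub>\<phi>"
    using s_act_y_whittaker by blast
  ultimately show ?thesis
    using exists_eigenvector_in_invariant_subspace[OF hom_s_act subspace_whittaker_vecs _ w] that by blast
qed

lemma dim_whittaker_eq_1:
  assumes w: "w \<in> V\<^sub>\<phi>" "w \<noteq> 0" and irr: "irreducible_mod sm B \<rho>"
    and E: "is_degree_op y I ls us"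
  shows "dim V\<^sub>\<phi> = 1"
proof -
  have cyclic: "V\<^sub>\<phi> \<subseteq> filtration v 0" if "v \<in> V\<^sub>\<phi>" "v \<noteq> 0" for v
    using whittaker_subset_filtration_0[OF that irr E] .
  obtain u c where u: "u \<in> V\<^sub>\<phi>" "u \<noteq> 0" and c: "s_act y u = sm c u"
    using whittaker_eigenvector[OF w cyclic] by blast
  have span: "V\<^sub>\<phi> = span {u}"
  proof
    show "V\<^sub>\<phi> \<subseteq> span {u}"
    proof
      fix x assume "x \<in> V\<^sub>\<phi>"
      then have "x \<in> filtration u 0"
        using cyclic[OF u] by blast
      then obtain g where "x = poly_act sm (s_act y) g u"
        unfolding filtration_0_iff by blast
      then have "x = sm (poly g c) u"
        using poly_act_eigenvector[OF hom_s_act c] by simp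
      then show "x \<in> span {u}"
        by (simp add: span_base span_scale)
    qed
    show "span {u} \<subseteq> V\<^sub>\<phi>"
      using u subspace_whittaker_vecs by (intro span_minimal) auto
  qed
  have "independent {u}"
    using u(2) by (intro independent_insertI) (auto simp: independent_empty)
  then show ?thesis
    unfolding span dim_span by (simp add: dim_eq_card_independent)
qed

end

section \<open>A three-dimensional complement\<close>

lemma sum_sc: "finite A \<Longrightarrow> (\<Sum>k\<in>A. sc x c0 k * f k) = (if c0 \<in> A then x * f c0 else 0)"
  unfolding sc_def by (simp add: if_distrib[of "\<lambda>t. t * _"] cong: if_cong)

locale semidirect_rep_3 = semidirect_rep +
  fixes e0 h0 f0 :: 'b
  assumes Bs_eq: "Bs = {e0, h0, f0}" and distinct: "e0 \<noteq> h0" "e0 \<noteq> f0" "h0 \<noteq> f0"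
begin

definition vec3 :: "complex \<Rightarrow> complex \<Rightarrow> complex \<Rightarrow> 'b \<Rightarrow> complex" where
  "vec3 x y z = (\<lambda>b. if b = e0 then x else if b = h0 then y else if b = f0 then z else 0)"

definition cross :: "('b \<Rightarrow> complex) \<Rightarrow> ('b \<Rightarrow> complex) \<Rightarrow> 'b \<Rightarrow> complex" where
  "cross r s = vec3 (r h0 * s f0 - r f0 * s h0) (r f0 * s e0 - r e0 * s f0) (r e0 * s h0 - r h0 * s e0)"

definition dot :: "('b \<Rightarrow> complex) \<Rightarrow> ('b \<Rightarrow> complex) \<Rightarrow> complex" where
  "dot r s = r e0 * s e0 + r h0 * s h0 + r f0 * s f0"

lemma vec3_simps [simp]: "vec3 x y z e0 = x" "vec3 x y z h0 = y" "vec3 x y z f0 = z"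
  unfolding vec3_def using distinct by auto

lemma sum_Bs: "(\<Sum>b\<in>Bs. f b) = f e0 + f h0 + f f0"
  using Bs_eq distinct by (simp add: add.assoc)

lemma cofactor_inverse:
  assumes D: "D = dot t (cross r1 r2)" "D \<noteq> 0" and a: "a \<in> Bs" and b: "b \<in> Bs"
  shows "r1 a * (cross r2 t b / D) + r2 a * (cross t r1 b / D)
           = (if b = a then 1 else 0) + (- t a / D) * cross r1 r2 b"
proof -
  have "r1 a * cross r2 t b + r2 a * cross t r1 b + t a * cross r1 r2 b = (if b = a then D else 0)"
    using a b D(1) Bs_eq distinct unfolding cross_def dot_def by (auto simp: algebra_simps)
  then show ?thesis
    using D(2) by (simp add: field_simps split: if_splits)
qed

lemma dot_cnj_self_eq_0:
  assumes "dot (vec3 (cnj (r e0)) (cnj (r h0)) (cnj (r f0))) r = 0" and "b \<in> Bs"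
  shows "r b = 0"
proof -
  have "dot (vec3 (cnj (r e0)) (cnj (r h0)) (cnj (r f0))) r
      = of_real ((cmod (r e0))\<^sup>2 + (cmod (r h0))\<^sup>2 + (cmod (r f0))\<^sup>2)"
    unfolding dot_def vec3_simps of_real_add complex_norm_square by (simp only: mult.commute)
  then have "(cmod (r e0))\<^sup>2 + (cmod (r h0))\<^sup>2 + (cmod (r f0))\<^sup>2 = 0"
    using assms(1) by (metis of_real_eq_0_iff)
  then show ?thesis
    using assms(2) Bs_eq by (auto simp: add_nonneg_eq_0_iff)
qed

text \<open>The conjugate of \<open>y = r\<^sub>1 \<times> r\<^sub>2\<close> completes the rows \<open>r\<^sub>1, r\<^sub>2\<close> to a matrix with determinant
  \<open>\<Sum> |y b|\<^sup>2 \<noteq> 0\<close>; its adjugate inverts the rows modulo \<open>y\<close>.\<close>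

lemma degree_op_mod_cross:
  assumes q1: "q1 \<in> Bp" and q2: "q2 \<in> Bp" and b: "b \<in> Bs" "cross (phi_br q1) (phi_br q2) b \<noteq> 0"
  shows "\<exists>ls us. is_degree_op (cross (phi_br q1) (phi_br q2)) {0::nat, 1} ls us"
proof -
  define y where "y = cross (phi_br q1) (phi_br q2)"
  define t where "t = vec3 (cnj (y e0)) (cnj (y h0)) (cnj (y f0))"
  define D where "D = dot t y"
  have "D \<noteq> 0"
    using dot_cnj_self_eq_0[of y b] b unfolding D_def t_def y_def by blast
  define ls where "ls = (\<lambda>i::nat. if i = 0 then sc 1 q1 else sc 1 q2)"
  define us where "us = (\<lambda>i::nat. if i = 0 then (\<lambda>b. cross (phi_br q2) t b / D) else (\<lambda>b. cross t (phi_br q1) b / D))"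
  have "is_degree_op y {0, 1} ls us"
    unfolding is_degree_op_def
  proof (intro ballI exI)
    fix a c assume "a \<in> Bs" "c \<in> Bs"
    then show "(\<Sum>i\<in>{0, 1}. (\<Sum>k\<in>Bp. ls i k * phi_br k a) * us i c) = (if c = a then 1 else 0) + (- t a / D) * y c"
      using cofactor_inverse[OF _ \<open>D \<noteq> 0\<close>, of t "phi_br q1" "phi_br q2"] q1 q2
      unfolding ls_def us_def D_def y_def by (simp add: sum_sc finite_Bp)
  qed
  then show ?thesis
    unfolding y_def by blast
qed

lemma degree_op_of_third_row:
  assumes q1: "q1 \<in> Bp" and q2: "q2 \<in> Bp" and q3: "q3 \<in> Bp"
    and D: "dot (phi_br q3) (cross (phi_br q1) (phi_br q2)) \<noteq> 0"
  shows "\<exists>ls us. is_degree_op (\<lambda>_. 0) {0::nat, 1, 2} ls us"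
proof -
  define y where "y = cross (phi_br q1) (phi_br q2)"
  define D where "D = dot (phi_br q3) y"
  define ls where "ls = (\<lambda>i::nat. if i = 0 then sc 1 q1 else if i = 1 then sc 1 q2 else sc 1 q3)"
  define us where "us = (\<lambda>i::nat. if i = 0 then (\<lambda>b. cross (phi_br q2) (phi_br q3) b / D)
    else if i = 1 then (\<lambda>b. cross (phi_br q3) (phi_br q1) b / D) else (\<lambda>b. y b / D))"
  have "is_degree_op (\<lambda>_. 0) {0, 1, 2} ls us"
    unfolding is_degree_op_def
  proof (intro ballI exI)
    fix a c assume "a \<in> Bs" "c \<in> Bs"
    then show "(\<Sum>i\<in>{0, 1, 2}. (\<Sum>k\<in>Bp. ls i k * phi_br k a) * us i c) = (if c = a then 1 else 0) + 0 * 0"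
      using cofactor_inverse[OF _ D[folded y_def D_def], of "phi_br q3" "phi_br q1" "phi_br q2"] q1 q2 q3 D
      unfolding ls_def us_def D_def y_def by (simp add: sum_sc finite_Bp field_simps)
  qed
  then show ?thesis
    by blast
qed

lemma cross_simps:
  "cross r s e0 = r h0 * s f0 - r f0 * s h0"
  "cross r s h0 = r f0 * s e0 - r e0 * s f0"
  "cross r s f0 = r e0 * s h0 - r h0 * s e0"
  unfolding cross_def by simp_all

text \<open>Either \<open>r\<^sub>1 \<times> r\<^sub>2 \<in> \<frak>g\<^sup>\<phi>\<close>, or a third row completes \<open>r\<^sub>1, r\<^sub>2\<close> to an invertible matrix and
  no correction by \<open>y\<close> is needed.\<close>

lemma dim_whittaker_eq_1_of_cross:
  assumes q1: "q1 \<in> Bp" and q2: "q2 \<in> Bp" and b: "b \<in> Bs" "cross (phi_br q1) (phi_br q2) b \<noteq> 0"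
    and w: "w \<in> V\<^sub>\<phi>" "w \<noteq> 0" and irr: "irreducible_mod sm B \<rho>"
  shows "dim V\<^sub>\<phi> = 1"
proof (cases "\<forall>q\<in>Bp. dot (phi_br q) (cross (phi_br q1) (phi_br q2)) = 0")
  case True
  interpret Y: semidirect_rep_y sm B Bs Bp br \<rho> \<phi> "cross (phi_br q1) (phi_br q2)"
    using True by unfold_locales (simp add: sum_Bs dot_def algebra_simps)
  obtain ls us where "is_degree_op (cross (phi_br q1) (phi_br q2)) {0::nat, 1} ls us"
    using degree_op_mod_cross[OF q1 q2 b] by blast
  then show ?thesis
    by (rule Y.dim_whittaker_eq_1[OF w irr])
next
  case False
  then obtain q3 where q3: "q3 \<in> Bp" and "dot (phi_br q3) (cross (phi_br q1) (phi_br q2)) \<noteq> 0"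
    by blast
  then obtain ls us where "is_degree_op (\<lambda>_. 0) {0::nat, 1, 2} ls us"
    using degree_op_of_third_row[OF q1 q2] by blast
  interpret Y: semidirect_rep_y sm B Bs Bp br \<rho> \<phi> "\<lambda>_. 0"
    by unfold_locales simp
  show ?thesis
    by (rule Y.dim_whittaker_eq_1[OF w irr \<open>is_degree_op (\<lambda>_. 0) {0::nat, 1, 2} ls us\<close>])
qed

lemma bland_of_cross:
  assumes irr: "irreducible_mod sm B \<rho>" and qw: "quasi_whittaker sm B Bp \<rho> \<phi>"
    and q1: "q1 \<in> Bp" and q2: "q2 \<in> Bp" and b: "b \<in> Bs" "cross (phi_br q1) (phi_br q2) b \<noteq> 0"
  shows "bland sm B Bp \<rho> \<phi>"
proof -
  obtain w where w: "w \<in> V\<^sub>\<phi>" and gen: "generated_submod sm B \<rho> w = UNIV"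
    using qw unfolding quasi_whittaker_def by blast
  have "w \<noteq> 0"
  proof
    assume "w = 0"
    have "is_submodule sm B \<rho> {0}"
      unfolding is_submodule_def using rho_0 by auto
    then have "generated_submod sm B \<rho> w \<subseteq> {0}"
      using \<open>w = 0\<close> unfolding generated_submod_def by blast
    then show False
      using gen irr unfolding irreducible_mod_def by auto
  qed
  then show ?thesis
    using dim_whittaker_eq_1_of_cross[OF q1 q2 b w] irr unfolding bland_def by blast
qed

end

lemma semidirect_rep_3I:
  assumes "is_rep sm B br \<rho>" "finite B" "B = {e0, h0, f0} \<union> Bp" "{e0, h0, f0} \<inter> Bp = {}"
    "\<forall>a\<in>B. \<forall>b\<in>Bp. \<forall>c\<in>{e0, h0, f0}. br a b c = 0 \<and> br b a c = 0"
    "\<forall>a\<in>{e0, h0, f0}. \<forall>b\<in>{e0, h0, f0}. \<forall>c\<in>Bp. br a b c = 0"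
    "e0 \<noteq> h0" "e0 \<noteq> f0" "h0 \<noteq> f0"
  shows "semidirect_rep_3 sm B {e0, h0, f0} Bp br \<rho> e0 h0 f0"
  using assms
  unfolding is_rep_def semidirect_rep_3_def semidirect_rep_def semidirect_rep_axioms_def semidirect_rep_3_axioms_def
  by auto

lemma semidirect_rep_3_cga:
  assumes "is_rep sm (cga_basis m) (cga_br m) \<rho>"
  shows "semidirect_rep_3 sm (cga_basis m) {cE, cH, cF} (cga_p m) (cga_br m) \<rho> cE cH cF"
proof (rule semidirect_rep_3I[OF assms])
  show "finite (cga_basis m)"
    by (simp add: cga_basis_def)
  show "cga_basis m = {cE, cH, cF} \<union> cga_p m"
    by (simp add: cga_basis_def cga_p_def)
  show "{cE, cH, cF} \<inter> cga_p m = {}"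
    by (auto simp: cga_p_def)
  show "\<forall>a\<in>cga_basis m. \<forall>b\<in>cga_p m. \<forall>c\<in>{cE, cH, cF}. cga_br m a b c = 0 \<and> cga_br m b a c = 0"
    by (auto simp: cga_basis_def cga_p_def sc_def)
  show "\<forall>a\<in>{cE, cH, cF}. \<forall>b\<in>{cE, cH, cF}. \<forall>c\<in>cga_p m. cga_br m a b c = 0"
    by (auto simp: cga_p_def sc_def)
qed auto

context
  fixes m :: nat and sm :: "complex \<Rightarrow> 'v::ab_group_add \<Rightarrow> 'v" and \<rho> :: "cga \<Rightarrow> 'v \<Rightarrow> 'v"
    and \<phi> :: "cga \<Rightarrow> complex"
  assumes rep: "is_rep sm (cga_basis m) (cga_br m) \<rho>"
begin

interpretation W: semidirect_rep_3 sm "cga_basis m" "{cE, cH, cF}" "cga_p m" "cga_br m" \<rho> \<phi> cE cH cF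
  by (rule semidirect_rep_3_cga[OF rep])

lemma cga_phi_br:
  "j \<le> m \<Longrightarrow> W.phi_br (cP j) cE = - of_nat j * \<phi> (cP (j - 1))"
  "j \<le> m \<Longrightarrow> W.phi_br (cP j) cH = (2 * of_nat j - of_nat m) * \<phi> (cP j)"
  "W.phi_br (cP j) cF = (if Suc j \<le> m then (of_nat j - of_nat m) * \<phi> (cP (Suc j)) else 0)"
  by (simp_all add: W.phi_br_def sum_sc W.finite_Bp) (auto simp: cga_p_def)

lemma cga_cross_nonzero:
  assumes m: "m \<ge> 1" and b: "b \<le> m" "\<phi> (cP b) \<noteq> 0" and below_b: "\<And>k. k < b \<Longrightarrow> \<phi> (cP k) = 0"
  shows "\<exists>q1\<in>cga_p m. \<exists>q2\<in>cga_p m. \<exists>b\<in>{cE, cH, cF}. W.cross (W.phi_br q1) (W.phi_br q2) b \<noteq> 0"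
proof -
  have inP: "cP j \<in> cga_p m" if "j \<le> m" for j
    using that by (simp add: cga_p_def)
  consider "b = 0" | "0 < b" "b < m" | "b = m" "0 < b"
    using b(1) by linarith
  then show ?thesis
  proof cases
    case 1
    have "W.cross (W.phi_br (cP 0)) (W.phi_br (cP 1)) cF \<noteq> 0"
      using m b 1 by (simp add: W.cross_simps cga_phi_br)
    then show ?thesis
      using inP[of 0] inP[of 1] m by blast
  next
    case 2
    have r1E: "W.phi_br (cP (b - 1)) cE = 0"
      using 2 below_b[of "b - 1 - 1"] by (cases "b = 1") (simp_all add: cga_phi_br)
    have r1F: "W.phi_br (cP (b - 1)) cF = (of_nat (b - 1) - of_nat m) * \<phi> (cP b)"
      using 2 by (simp add: cga_phi_br)
    have r2E: "W.phi_br (cP (b + 1)) cE = - of_nat (b + 1) * \<phi> (cP b)"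
      using 2 by (simp add: cga_phi_br)
    have "(of_nat (b - 1) - of_nat m :: complex) \<noteq> 0"
      by (simp only: right_minus_eq of_nat_eq_iff) (use 2 in linarith)
    moreover have "W.cross (W.phi_br (cP (b - 1))) (W.phi_br (cP (b + 1))) cH
        = ((of_nat (b - 1) - of_nat m) * \<phi> (cP b)) * (- of_nat (b + 1) * \<phi> (cP b))"
      by (simp only: W.cross_simps r1E r1F r2E mult_zero_left diff_zero)
    ultimately have "W.cross (W.phi_br (cP (b - 1))) (W.phi_br (cP (b + 1))) cH \<noteq> 0"
      using b by (simp del: of_nat_add of_nat_Suc)
    then show ?thesis
      using inP[of "b - 1"] inP[of "b + 1"] 2 by auto
  next
    case 3
    have "W.phi_br (cP (m - 1)) cH = 0"
      using 3 below_b[of "m - 1"] by (simp add: cga_phi_br)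
    then have "W.cross (W.phi_br (cP (m - 1))) (W.phi_br (cP m)) cE \<noteq> 0"
      using b 3 by (simp add: W.cross_simps cga_phi_br of_nat_diff)
    then show ?thesis
      using inP[of "m - 1"] inP[of m] by auto
  qed
qed

lemma cga_bland:
  assumes "m \<ge> 1" "nonzero_on (cga_p m) \<phi>"
    and "irreducible_mod sm (cga_basis m) \<rho>" "quasi_whittaker sm (cga_basis m) (cga_p m) \<rho> \<phi>"
  shows "bland sm (cga_basis m) (cga_p m) \<rho> \<phi>"
proof -
  have ex: "\<exists>k. k \<le> m \<and> \<phi> (cP k) \<noteq> 0"
    using assms(2) unfolding nonzero_on_def cga_p_def by auto
  define b where "b = (LEAST k. k \<le> m \<and> \<phi> (cP k) \<noteq> 0)"
  have b: "b \<le> m" "\<phi> (cP b) \<noteq> 0"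
    using LeastI_ex[OF ex] unfolding b_def by auto
  have "\<phi> (cP k) = 0" if "k < b" for k
    using not_less_Least[of k "\<lambda>k. k \<le> m \<and> \<phi> (cP k) \<noteq> 0"] that b(1) unfolding b_def by auto
  then show ?thesis
    using cga_cross_nonzero[OF assms(1) b] W.bland_of_cross[OF assms(3,4)] by blast
qed

end

lemma semidirect_rep_3_sch:
  assumes "is_rep sm (sch_basis n) sch_br \<rho>"
  shows "semidirect_rep_3 sm (sch_basis n) {sE, sH, sF} (sch_p n) sch_br \<rho> sE sH sF"
proof (rule semidirect_rep_3I[OF assms])
  show "finite (sch_basis n)"
    by (simp add: sch_basis_def)
  show "sch_basis n = {sE, sH, sF} \<union> sch_p n"
    by (auto simp: sch_basis_def sch_p_def)
  show "{sE, sH, sF} \<inter> sch_p n = {}"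
    by (auto simp: sch_p_def)
  show "\<forall>a\<in>sch_basis n. \<forall>b\<in>sch_p n. \<forall>c\<in>{sE, sH, sF}. sch_br a b c = 0 \<and> sch_br b a c = 0"
    by (auto simp: sch_basis_def sch_p_def sc_def)
  show "\<forall>a\<in>{sE, sH, sF}. \<forall>b\<in>{sE, sH, sF}. \<forall>c\<in>sch_p n. sch_br a b c = 0"
    by (auto simp: sch_p_def sc_def)
qed auto

context
  fixes n :: nat and sm :: "complex \<Rightarrow> 'v::ab_group_add \<Rightarrow> 'v" and \<rho> :: "sch \<Rightarrow> 'v \<Rightarrow> 'v"
    and \<phi> :: "sch \<Rightarrow> complex"
  assumes rep: "is_rep sm (sch_basis n) sch_br \<rho>"
begin

interpretation W: semidirect_rep_3 sm "sch_basis n" "{sE, sH, sF}" "sch_p n" sch_br \<rho> \<phi> sE sH sF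
  by (rule semidirect_rep_3_sch[OF rep])

lemma sch_cross_nonzero:
  assumes n: "n \<ge> 1" and hom: "lie_hom_on_p (sch_p n) sch_br \<phi>" and nz: "nonzero_on (sch_p n) \<phi>"
  shows "\<exists>q1\<in>sch_p n. \<exists>q2\<in>sch_p n. \<exists>b\<in>{sE, sH, sF}. W.cross (W.phi_br q1) (W.phi_br q2) b \<noteq> 0"
proof -
  have xy: "sX i \<in> sch_p n" "sY i \<in> sch_p n" if "i \<in> {1..n}" for i
    using that by (auto simp: sch_p_def)
  have "sX 1 \<in> sch_p n" "sY 1 \<in> sch_p n"
    using xy[of 1] n by auto
  then have "(\<Sum>c\<in>sch_p n. sch_br (sX 1) (sY 1) c * \<phi> c) = 0"
    using hom unfolding lie_hom_on_p_def by blast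
  then have "\<phi> sZ = 0"
    by (simp add: sum_sc W.finite_Bp) (simp add: sch_p_def)
  then obtain i where i: "i \<in> {1..n}" and "\<phi> (sX i) \<noteq> 0 \<or> \<phi> (sY i) \<noteq> 0"
    using nz unfolding nonzero_on_def sch_p_def by auto
  moreover have "W.cross (W.phi_br (sX i)) (W.phi_br (sY i)) sE = (\<phi> (sY i))\<^sup>2"
    and "W.cross (W.phi_br (sX i)) (W.phi_br (sY i)) sF = - (\<phi> (sX i))\<^sup>2"
    using xy[OF i] by (simp_all add: W.cross_simps W.phi_br_def sum_sc W.finite_Bp power2_eq_square)
  ultimately show ?thesis
    using xy[OF i] by force
qed

lemma sch_bland:
  assumes "n \<ge> 1" "lie_hom_on_p (sch_p n) sch_br \<phi>" "nonzero_on (sch_p n) \<phi>"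
    and "irreducible_mod sm (sch_basis n) \<rho>" "quasi_whittaker sm (sch_basis n) (sch_p n) \<rho> \<phi>"
  shows "bland sm (sch_basis n) (sch_p n) \<rho> \<phi>"
  using sch_cross_nonzero[OF assms(1-3)] W.bland_of_cross[OF assms(4,5)] by blast

end

theorem theorem4p1:
  shows
  "(\<forall>(m::nat) (sm :: complex \<Rightarrow> 'v::ab_group_add \<Rightarrow> 'v) (\<rho> :: cga \<Rightarrow> 'v \<Rightarrow> 'v) (\<phi> :: cga \<Rightarrow> complex).
      m \<ge> 1 \<and> lie_hom_on_p (cga_p m) (cga_br m) \<phi> \<and> nonzero_on (cga_p m) \<phi> \<and>
      is_rep sm (cga_basis m) (cga_br m) \<rho> \<and>
      irreducible_mod sm (cga_basis m) \<rho> \<and>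
      quasi_whittaker sm (cga_basis m) (cga_p m) \<rho> \<phi>
      \<longrightarrow> bland sm (cga_basis m) (cga_p m) \<rho> \<phi>)
   \<and>
   (\<forall>(n::nat) (sm :: complex \<Rightarrow> 'w::ab_group_add \<Rightarrow> 'w) (\<rho> :: sch \<Rightarrow> 'w \<Rightarrow> 'w) (\<phi> :: sch \<Rightarrow> complex).
      n \<ge> 1 \<and> lie_hom_on_p (sch_p n) sch_br \<phi> \<and> nonzero_on (sch_p n) \<phi> \<and>
      is_rep sm (sch_basis n) sch_br \<rho> \<and>
      irreducible_mod sm (sch_basis n) \<rho> \<and>
      quasi_whittaker sm (sch_basis n) (sch_p n) \<rho> \<phi>
      \<longrightarrow> bland sm (sch_basis n) (sch_p n) \<rho> \<phi>)"
  using cga_bland sch_bland by blast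

end
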